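(* For every positive integer $n$, $$\operatorname{bdim}(\mathcal{B}_n) \leq \left\lceil \tfrac{5}{6}\, n \right\rceil.$$
   Context: A poset $P=(X,\leq)$ is a non-empty set $X$ (the ground set) with a reflexive, antisymmetric and transitive relation $\leq$. A linear order is a poset in which any two elements are comparable. For a linear order $L$ and elements $x,y$ of $L$, let $[x \leq_L y] \in \{0,1\}$ be $1$ if $x \leq y$ in $L$ and $0$ otherwise. For linear orders $L_1,\dots,L_d$ on the same ground set, write $[x \leq_{L_i} y]_{i=1}^d = ([x\leq_{L_1} y],\dots,[x \leq_{L_d} y]) \in \{0,1\}^d$. Boolean dimension: let $P$ be a poset with at least two elements and $d$ a nonnegative integer. A pair $((L_1,\dots,L_d),\phi)$, where $L_1,\dots,L_d$ are (arbitrary) linear orders on the ground set of $P$ and $\phi:\{0,1\}^d\to\{0,1\}$ is any map, is a Boolean realizer of $P$ of size $d$ if for every pair of elements $x,y$ of $P$: $x \leq y$ in $P$ if and only if $\phi([x\leq_{L_i} y]_{i=1}^d)=1$. The Boolean dimension $\operatorname{bdim}(P)$ is the minimum size of a Boolean realizer of $P$. For a positive integer $n$, $[n]=\{1,\dots,n\}$ and the Boolean lattice $\mathcal{B}_n$ is the poset of all subsets of $[n]$ ordered by inclusion. *)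

theory Defs
  imports Complex_Main "HOL-Library.Extended_Nat"
begin

text \<open>
  A poset is a pair of a ground set and an order relation on it. A vector in \<open>{0,1}^d\<close> is a
  \<^typ>\<open>bool list\<close> of length \<open>d\<close>, with \<^const>\<open>True\<close> standing for \<open>1\<close>; the values of
  \<open>\<phi>\<close> on lists of other lengths are irrelevant.
\<close>

type_synonym 'a poset = "'a set \<times> 'a rel"

definition is_poset :: "'a poset \<Rightarrow> bool" where
  "is_poset P \<longleftrightarrow> fst P \<noteq> {} \<and> partial_order_on (fst P) (snd P)"

definition comparison_vector :: "'a rel list \<Rightarrow> 'a \<Rightarrow> 'a \<Rightarrow> bool list" where
  "comparison_vector Ls x y = map (\<lambda>L. (x, y) \<in> L) Ls"

definition boolean_realizer :: "'a poset \<Rightarrow> 'a rel list \<Rightarrow> (bool list \<Rightarrow> bool) \<Rightarrow> bool" where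
  "boolean_realizer P Ls \<phi> \<longleftrightarrow>
     (\<forall>L\<in>set Ls. linear_order_on (fst P) L) \<and>
     (\<forall>x\<in>fst P. \<forall>y\<in>fst P. (x, y) \<in> snd P \<longleftrightarrow> \<phi> (comparison_vector Ls x y))"

text \<open>
  Intended for posets with at least two elements. The infimum is a minimum whenever \<open>P\<close> has a
  Boolean realizer at all (as every finite poset does), and is \<open>\<infinity>\<close> otherwise.
\<close>

definition bdim :: "'a poset \<Rightarrow> enat" where
  "bdim P = (INF d \<in> {d. \<exists>Ls \<phi>. length Ls = d \<and> boolean_realizer P Ls \<phi>}. enat d)"

definition boolean_lattice :: "nat \<Rightarrow> nat set poset" where
  "boolean_lattice n = (Pow {1..n}, relation_of (\<subseteq>) (Pow {1..n}))"

lemma is_poset_boolean_lattice: "is_poset (boolean_lattice n)"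
  by (auto simp: is_poset_def boolean_lattice_def relation_of_def order_on_defs refl_on_def
      intro!: transI antisymI)

lemma card_boolean_lattice: "card (fst (boolean_lattice n)) = 2 ^ n"
  by (simp add: boolean_lattice_def card_Pow)

lemma bdim_le_iff:
  "bdim P \<le> enat k \<longleftrightarrow> (\<exists>Ls \<phi>. length Ls \<le> k \<and> boolean_realizer P Ls \<phi>)"
proof
  define S where "S = enat ` {d. \<exists>Ls \<phi>. length Ls = d \<and> boolean_realizer P Ls \<phi>}"
  assume le: "bdim P \<le> enat k"
  have bdim: "bdim P = Inf S"
    by (simp only: bdim_def S_def)
  have "S \<noteq> {}"
  proof
    assume "S = {}"
    with le bdim show False
      by (simp add: Inf_enat_def)
  qed
  then obtain s where "s \<in> S"
    by blast
  then have "(LEAST x. x \<in> S) \<in> S"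
    by (rule LeastI)
  with \<open>S \<noteq> {}\<close> have "bdim P \<in> S"
    by (simp add: bdim Inf_enat_def)
  then obtain Ls \<phi> where "bdim P = enat (length Ls)" "boolean_realizer P Ls \<phi>"
    unfolding S_def by blast
  with le show "\<exists>Ls \<phi>. length Ls \<le> k \<and> boolean_realizer P Ls \<phi>"
    by (metis enat_ord_simps(1))
next
  assume "\<exists>Ls \<phi>. length Ls \<le> k \<and> boolean_realizer P Ls \<phi>"
  then obtain Ls \<phi> where "length Ls \<le> k" "boolean_realizer P Ls \<phi>" by blast
  then show "bdim P \<le> enat k"
    unfolding bdim_def by (intro INF_lower2[of "length Ls"]) auto
qed

end

theory Submission
  imports Defs "HOL-Library.Nat_Bijection"
begin

text \<open>
  Boolean dimension is subadditive over products of posets (lemma \<open>bdim_product_poset_le\<close>), and the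
  subsets of a disjoint union \<open>S \<union> T\<close> are the pairs of a subset of \<open>S\<close> and a subset of \<open>T\<close>. Hence
  the Boolean dimension of the Boolean lattice is subadditive in \<open>n\<close>. As one order suffices for
  \<open>n = 1\<close>, this alone gives the bound \<open>n\<close>, and a single saving at \<open>n = 6\<close> improves the constant: if
  five orders suffice for six elements, then writing \<open>n = 6 * k + r\<close> with \<open>r < 6\<close> gives
  \<open>5 * k + r\<close>, which is \<open>\<lceil>5 / 6 * n\<rceil>\<close>.

  Subadditivity combines a realizer of \<open>P\<close> and one of \<open>Q\<close>. Each order on \<open>P\<close> is extended
  lexicographically to \<open>P \<times> Q\<close> with \<open>P\<close> as the leading coordinate, so that it still reports the
  comparison in \<open>P\<close> exactly whenever the two \<open>P\<close>-coordinates differ. If they agree, the comparison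
  in \<open>P\<close> holds and must not be denied when the whole pair is comparable. Breaking ties by a linear
  extension of \<open>Q\<close> ensures this: if the \<open>Q\<close>-coordinates are comparable in the right direction, the
  orders report the same vector as for equal elements of \<open>P\<close>. If they are not, the half belonging to
  \<open>Q\<close> rejects the pair, whatever the first half says.

  For six elements (lemma \<open>bdim_boolean_lattice_6\<close>) the realizer is a voting rule: there are five
  linear orders on the 64 subsets such that \<open>A \<subseteq> B\<close> holds if and only if at least four of them put
  \<open>A\<close> before or level with \<open>B\<close>. Equivalently, the five orders are divided 3 to 2 over every pair of
  incomparable sets, while at most one of them reverses a given strict inclusion. The orders are an
  explicit solution of this finite combinatorial problem and are given by a table, for which the rule
  is checked on all pairs.
\<close>

section \<open>Boolean realizers of subposets and products\<close>

definition pullback_on :: "'a set \<Rightarrow> ('a \<Rightarrow> 'b) \<Rightarrow> 'b rel \<Rightarrow> 'a rel" where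
  "pullback_on X f L = {(x, y). x \<in> X \<and> y \<in> X \<and> (f x, f y) \<in> L}"

lemma linear_order_on_pullback_on:
  assumes "linear_order_on Y L" and "f ` X \<subseteq> Y" and "inj_on f X"
  shows "linear_order_on X (pullback_on X f L)"
proof -
  have total: "(f x, f y) \<in> L \<or> (f y, f x) \<in> L" if "x \<in> X" "y \<in> X" "x \<noteq> y" for x y
    using assms that unfolding order_on_defs total_on_def inj_on_def by (metis image_subset_iff)
  show ?thesis
    using assms total unfolding order_on_defs pullback_on_def total_on_def refl_on_def
    by (auto intro!: transI antisymI dest: transD antisymD inj_onD)
qed

lemma linear_order_on_rank:
  fixes f :: "'a \<Rightarrow> 'b :: linorder"
  assumes "inj_on f X"
  shows "linear_order_on X (pullback_on X f {(a, b). a \<le> b})"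
proof -
  have "linear_order_on UNIV {(a, b :: 'b). a \<le> b}"
    by (auto simp: order_on_defs refl_on_def total_on_def intro!: transI antisymI)
  then show ?thesis
    by (rule linear_order_on_pullback_on) (use assms in simp_all)
qed

text \<open>
  Pulling back the orders of a realizer leaves all comparison vectors unchanged, so the same decision
  map works for every subposet.
\<close>

lemma bdim_le_if_order_embedding:
  assumes bdim: "bdim Q \<le> enat d"
    and maps: "f ` fst P \<subseteq> fst Q" and inj: "inj_on f (fst P)"
    and embeds: "\<And>x y. x \<in> fst P \<Longrightarrow> y \<in> fst P \<Longrightarrow> (x, y) \<in> snd P \<longleftrightarrow> (f x, f y) \<in> snd Q"
  shows "bdim P \<le> enat d"
proof -
  obtain Ls \<phi> where len: "length Ls \<le> d" and real: "boolean_realizer Q Ls \<phi>"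
    using bdim unfolding bdim_le_iff by blast
  define Ls' where "Ls' = map (pullback_on (fst P) f) Ls"
  have "comparison_vector Ls' x y = comparison_vector Ls (f x) (f y)"
    if "x \<in> fst P" "y \<in> fst P" for x y
    using that by (auto simp: Ls'_def comparison_vector_def pullback_on_def)
  moreover have "\<forall>L\<in>set Ls'. linear_order_on (fst P) L"
    using real maps inj
    by (auto simp: Ls'_def boolean_realizer_def intro!: linear_order_on_pullback_on)
  ultimately have "boolean_realizer P Ls' \<phi>"
    using real maps embeds by (auto simp: boolean_realizer_def image_subset_iff)
  then show ?thesis
    using len unfolding bdim_le_iff by (intro exI[of _ Ls'] exI[of _ \<phi>]) (simp add: Ls'_def)
qed

text \<open>
  This differs from \<open>L <*lex*> M\<close>, which relates two pairs as soon as \<open>L\<close> relates their leading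
  coordinates: as \<open>L\<close> is reflexive, that relation would never consult the tie-breaking order \<open>M\<close>.
\<close>

definition lex_order :: "'a set \<Rightarrow> 'b set \<Rightarrow> 'b rel \<Rightarrow> 'a rel \<Rightarrow> ('a \<times> 'b) rel" where
  "lex_order X Y M L =
    {((p, q), (p', q')). p \<in> X \<and> p' \<in> X \<and> q \<in> Y \<and> q' \<in> Y \<and>
      (if p = p' then (q, q') \<in> M else (p, p') \<in> L)}"

lemma linear_order_on_lex_order:
  assumes L: "linear_order_on X L" and M: "linear_order_on Y M"
  shows "linear_order_on (X \<times> Y) (lex_order X Y M L)"
proof -
  have "trans (lex_order X Y M L)"
  proof (rule transI, clarify)
    fix p q p' q' p'' q''
    assume 1: "((p, q), (p', q')) \<in> lex_order X Y M L"
      and 2: "((p', q'), (p'', q'')) \<in> lex_order X Y M L"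
    have "trans L" "antisym L" "trans M"
      using L M by (auto simp: order_on_defs)
    with 1 2 show "((p, q), (p'', q'')) \<in> lex_order X Y M L"
      unfolding lex_order_def
      by (auto split: if_splits dest: transD antisymD)
  qed
  moreover have "antisym (lex_order X Y M L)"
    using L M unfolding order_on_defs lex_order_def
    by (auto intro!: antisymI split: if_splits dest: antisymD)
  moreover have "refl_on (X \<times> Y) (lex_order X Y M L)" "total_on (X \<times> Y) (lex_order X Y M L)"
    using L M unfolding order_on_defs lex_order_def refl_on_def total_on_def by auto
  ultimately show ?thesis
    unfolding order_on_defs by (auto simp: lex_order_def)
qed

text \<open>
  The tie-breaking order can spoil the information of the leading coordinates only for equal leading
  coordinates, and then only by reporting \<open>q'\<close> before \<open>q\<close>.
\<close>

lemma comparison_vector_lex_order: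
  assumes "\<forall>L\<in>set Ls. linear_order_on X L" and "p \<in> X" "p' \<in> X" "q \<in> Y" "q' \<in> Y"
    and "p = p' \<Longrightarrow> (q, q') \<in> M"
  shows "comparison_vector (map (lex_order X Y M) Ls) (p, q) (p', q') = comparison_vector Ls p p'"
  using assms
  by (auto simp: comparison_vector_def lex_order_def order_on_defs refl_on_def)

definition product_poset :: "'a poset \<Rightarrow> 'b poset \<Rightarrow> ('a \<times> 'b) poset" where
  "product_poset P Q =
    (fst P \<times> fst Q, {((p, q), (p', q')). (p, p') \<in> snd P \<and> (q, q') \<in> snd Q})"

text \<open>
  Both halves of the vector must accept. A positive pair is positive in both coordinates, hence
  respected by both tie-breaking linear extensions, and both halves are exact. A negative pair is
  negative in some coordinate; the two entries in that coordinate differ by reflexivity, so the half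
  belonging to it is exact and rejects.
\<close>

lemma bdim_product_poset_le:
  assumes "bdim P \<le> enat a" and "bdim Q \<le> enat b"
    and P: "is_poset P" "linear_order_on (fst P) MP" "snd P \<subseteq> MP"
    and Q: "is_poset Q" "linear_order_on (fst Q) MQ" "snd Q \<subseteq> MQ"
  shows "bdim (product_poset P Q) \<le> enat (a + b)"
proof -
  obtain Ls \<phi> where Ls: "length Ls \<le> a" and realP: "boolean_realizer P Ls \<phi>"
    using assms(1) unfolding bdim_le_iff by blast
  obtain Ks \<psi> where Ks: "length Ks \<le> b" and realQ: "boolean_realizer Q Ks \<psi>"
    using assms(2) unfolding bdim_le_iff by blast
  have linP: "\<forall>L\<in>set Ls. linear_order_on (fst P) L"
    and linQ: "\<forall>K\<in>set Ks. linear_order_on (fst Q) K"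
    using realP realQ by (simp_all add: boolean_realizer_def)
  let ?Z = "fst P \<times> fst Q"
  define Ls' where "Ls' = map (lex_order (fst P) (fst Q) MQ) Ls"
  define Ks' where "Ks' = map (pullback_on ?Z prod.swap) (map (lex_order (fst Q) (fst P) MP) Ks)"
  define \<chi> where
    "\<chi> v \<longleftrightarrow> \<phi> (take (length Ls) v) \<and> \<psi> (drop (length Ls) v)" for v
  have reflP: "(p, p) \<in> snd P" if "p \<in> fst P" for p
    using P(1) that by (auto simp: is_poset_def order_on_defs refl_on_def)
  have reflQ: "(q, q) \<in> snd Q" if "q \<in> fst Q" for q
    using Q(1) that by (auto simp: is_poset_def order_on_defs refl_on_def)
  have "(z, z') \<in> snd (product_poset P Q) \<longleftrightarrow> \<chi> (comparison_vector (Ls' @ Ks') z z')"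
    if "z \<in> ?Z" "z' \<in> ?Z" for z z'
  proof -
    obtain p q p' q' where z: "z = (p, q)" "z' = (p', q')"
      by (cases z, cases z')
    then have in_carrier: "p \<in> fst P" "p' \<in> fst P" "q \<in> fst Q" "q' \<in> fst Q"
      using that by auto
    let ?u = "comparison_vector Ls' z z'" and ?v = "comparison_vector Ks' z z'"
    have u: "?u = comparison_vector Ls p p'" if "p = p' \<Longrightarrow> (q, q') \<in> MQ"
      unfolding z Ls'_def using linP in_carrier that by (rule comparison_vector_lex_order)
    have "?v = comparison_vector (map (lex_order (fst Q) (fst P) MP) Ks) (q, p) (q', p')"
      using in_carrier by (simp add: Ks'_def z comparison_vector_def pullback_on_def)
    then have v: "?v = comparison_vector Ks q q'" if "q = q' \<Longrightarrow> (p, p') \<in> MP"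
      using comparison_vector_lex_order[OF linQ, of q q' p "fst P" p' MP] in_carrier that by simp
    have \<phi>: "(p, p') \<in> snd P \<longleftrightarrow> \<phi> (comparison_vector Ls p p')"
      and \<psi>: "(q, q') \<in> snd Q \<longleftrightarrow> \<psi> (comparison_vector Ks q q')"
      using realP realQ in_carrier by (simp_all add: boolean_realizer_def)
    have "\<chi> (comparison_vector (Ls' @ Ks') z z') \<longleftrightarrow> \<phi> ?u \<and> \<psi> ?v"
      by (simp add: \<chi>_def comparison_vector_def Ls'_def)
    also have "\<dots> \<longleftrightarrow> (p, p') \<in> snd P \<and> (q, q') \<in> snd Q"
    proof (cases "(p, p') \<in> snd P \<and> (q, q') \<in> snd Q")
      case True
      then have "(p, p') \<in> MP" "(q, q') \<in> MQ"
        using P(3) Q(3) by auto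
      with True u v \<phi> \<psi> show ?thesis
        by simp
    next
      case False
      then consider "(p, p') \<notin> snd P" | "(q, q') \<notin> snd Q"
        by blast
      then show ?thesis
      proof cases
        case 1
        then have "p \<noteq> p'"
          using reflP in_carrier by blast
        with 1 u \<phi> show ?thesis
          by simp
      next
        case 2
        then have "q \<noteq> q'"
          using reflQ in_carrier by blast
        with 2 v \<psi> show ?thesis
          by simp
      qed
    qed
    finally show ?thesis
      by (simp add: product_poset_def z)
  qed
  moreover have "\<forall>L\<in>set (Ls' @ Ks'). linear_order_on ?Z L"
  proof
    fix L assume "L \<in> set (Ls' @ Ks')"
    then consider "L \<in> set Ls'" | "L \<in> set Ks'"
      by auto
    then show "linear_order_on ?Z L"
    proof cases
      case 1
      then show ?thesis
        using linP Q(2) by (auto simp: Ls'_def intro: linear_order_on_lex_order)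
    next
      case 2
      then obtain K where K: "K \<in> set Ks"
        and L: "L = pullback_on ?Z prod.swap (lex_order (fst Q) (fst P) MP K)"
        by (auto simp: Ks'_def)
      have "linear_order_on (fst Q \<times> fst P) (lex_order (fst Q) (fst P) MP K)"
        using linQ K P(2) by (auto intro: linear_order_on_lex_order)
      then show ?thesis
        unfolding L by (rule linear_order_on_pullback_on) (auto simp: inj_on_def)
    qed
  qed
  ultimately have "boolean_realizer (product_poset P Q) (Ls' @ Ks') \<chi>"
    by (simp add: boolean_realizer_def product_poset_def)
  moreover have "length (Ls' @ Ks') \<le> a + b"
    using Ls Ks by (simp add: Ls'_def Ks'_def)
  ultimately show ?thesis
    unfolding bdim_le_iff by blast
qed


section \<open>Subadditivity over Boolean lattices\<close>

lemma fst_boolean_lattice [simp]: "fst (boolean_lattice n) = Pow {1..n}"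
  by (simp add: boolean_lattice_def)

lemma in_snd_boolean_lattice [simp]:
  "(A, B) \<in> snd (boolean_lattice n) \<longleftrightarrow> A \<subseteq> B \<and> B \<subseteq> {1..n}"
  by (auto simp: boolean_lattice_def relation_of_def)

text \<open>
  Reading a set as a binary number is injective, and a larger set has more summands.
\<close>

lemma boolean_lattice_linear_extension:
  obtains M where "linear_order_on (fst (boolean_lattice n)) M" "snd (boolean_lattice n) \<subseteq> M"
proof
  let ?M = "pullback_on (Pow {1..n}) set_encode {(a, b). a \<le> b}"
  have "inj_on set_encode (Pow {1..n})"
    by (rule inj_on_subset[OF inj_on_set_encode]) (auto intro: finite_subset)
  then show "linear_order_on (fst (boolean_lattice n)) ?M"
    by (simp add: linear_order_on_rank)
  have "set_encode A \<le> set_encode B" if "A \<subseteq> B" "B \<subseteq> {1..n}" for A B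
    using that unfolding set_encode_def by (intro sum_mono2) (auto intro: finite_subset)
  then show "snd (boolean_lattice n) \<subseteq> ?M"
    by (auto simp: boolean_lattice_def relation_of_def pullback_on_def)
qed

lemma bdim_boolean_lattice_add_le:
  assumes "bdim (boolean_lattice m) \<le> enat a" and "bdim (boolean_lattice n) \<le> enat b"
  shows "bdim (boolean_lattice (m + n)) \<le> enat (a + b)"
proof -
  obtain M where M: "linear_order_on (fst (boolean_lattice m)) M" "snd (boolean_lattice m) \<subseteq> M"
    by (rule boolean_lattice_linear_extension)
  obtain N where N: "linear_order_on (fst (boolean_lattice n)) N" "snd (boolean_lattice n) \<subseteq> N"
    by (rule boolean_lattice_linear_extension)
  \<comment> \<open>Split a set at \<open>m\<close> and shift its upper part down to \<open>{1..n}\<close>.\<close>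
  define f where "f A = (A \<inter> {1..m}, {i \<in> {1..n}. i + m \<in> A})" for A
  have embeds: "A \<subseteq> B \<longleftrightarrow> fst (f A) \<subseteq> fst (f B) \<and> snd (f A) \<subseteq> snd (f B)"
    if A: "A \<subseteq> {1..m + n}" for A B
  proof
    assume sub: "fst (f A) \<subseteq> fst (f B) \<and> snd (f A) \<subseteq> snd (f B)"
    show "A \<subseteq> B"
    proof
      fix i assume "i \<in> A"
      with A have i: "1 \<le> i" "i \<le> m + n" by auto
      show "i \<in> B"
      proof (cases "i \<le> m")
        case True
        with sub i \<open>i \<in> A\<close> show ?thesis by (auto simp: f_def)
      next
        case False
        with i \<open>i \<in> A\<close> have "i - m \<in> snd (f A)" by (auto simp: f_def)
        with sub have "i - m \<in> snd (f B)" by blast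
        with False show ?thesis by (simp add: f_def)
      qed
    qed
  qed (auto simp: f_def)
  show ?thesis
  proof (rule bdim_le_if_order_embedding)
    show "bdim (product_poset (boolean_lattice m) (boolean_lattice n)) \<le> enat (a + b)"
      by (rule bdim_product_poset_le[OF assms is_poset_boolean_lattice M is_poset_boolean_lattice N])
    show "f ` fst (boolean_lattice (m + n))
        \<subseteq> fst (product_poset (boolean_lattice m) (boolean_lattice n))"
      by (auto simp: product_poset_def f_def)
    show "inj_on f (fst (boolean_lattice (m + n)))"
    proof (rule inj_onI)
      fix A B assume "A \<in> fst (boolean_lattice (m + n))" "B \<in> fst (boolean_lattice (m + n))"
        and "f A = f B"
      then show "A = B" using embeds[of A B] embeds[of B A] by auto
    qed
  next
    fix A B assume AB: "A \<in> fst (boolean_lattice (m + n))" "B \<in> fst (boolean_lattice (m + n))"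
    have "fst (f B) \<subseteq> {1..m}" "snd (f B) \<subseteq> {1..n}"
      by (auto simp: f_def)
    with AB embeds[of A B] show "(A, B) \<in> snd (boolean_lattice (m + n)) \<longleftrightarrow>
        (f A, f B) \<in> snd (product_poset (boolean_lattice m) (boolean_lattice n))"
      by (cases "f A"; cases "f B") (auto simp: product_poset_def)
  qed
qed

lemma bdim_boolean_lattice_le: "bdim (boolean_lattice n) \<le> enat n"
proof (induction n)
  case 0
  have "boolean_realizer (boolean_lattice 0) [] (\<lambda>_. True)"
    by (auto simp: boolean_realizer_def)
  then show ?case
    unfolding bdim_le_iff by (intro exI[of _ "[]"]) auto
next
  case (Suc n)
  \<comment> \<open>The one-element set has just two subsets, so inclusion itself is the required linear order.\<close>
  have "linear_order_on (Pow {1..1}) (snd (boolean_lattice 1))"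
    using is_poset_boolean_lattice[of 1]
    by (auto simp: is_poset_def linear_order_on_def total_on_def)
  then have "boolean_realizer (boolean_lattice 1) [snd (boolean_lattice 1)] hd"
    by (simp add: boolean_realizer_def comparison_vector_def)
  then have "bdim (boolean_lattice 1) \<le> enat 1"
    unfolding bdim_le_iff by (intro exI[of _ "[snd (boolean_lattice 1)]"]) auto
  from bdim_boolean_lattice_add_le[OF Suc.IH this] show ?case
    by simp
qed


section \<open>Five linear orders for the subsets of a six-element set\<close>

text \<open>
  Row \<open>j\<close> lists the ranks in the \<open>j\<close>-th order of the subsets \<open>A\<close> of \<open>{1..6}\<close>, sorted by the binary
  number \<open>\<Sum>i\<in>A. 2 ^ (i - 1)\<close>.
\<close>

definition subset_ranks :: "int list list" where
  "subset_ranks =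
     [[1, 22, 39, 41, 20, 33, 40, 46, 2, 30, 5, 43, 0, 32, 27, 47, 9, 24, 51, 52, 16, 28, 57, 58,
       11, 34, 13, 60, 18, 35, 14, 61, 3, 23, 42, 44, 54, 29, 48, 49, 6, 31, 7, 45, 4, 37, 8, 50,
       10, 25, 53, 55, 21, 26, 59, 62, 12, 36, 15, 56, 17, 38, 19, 63],
      [17, 59, 5, 57, 29, 35, 33, 44, 18, 19, 24, 45, 30, 37, 40, 41, 46, 47, 6, 9, 49, 48, 52,
       10, 53, 3, 61, 1, 54, 63, 55, 7, 2, 13, 12, 14, 31, 36, 34, 38, 20, 22, 25, 26, 32, 39,
       42, 43, 0, 15, 11, 16, 51, 50, 8, 21, 4, 23, 27, 28, 56, 60, 58, 62],
      [0, 25, 4, 27, 1, 30, 9, 34, 37, 42, 47, 48, 38, 45, 11, 51, 14, 28, 17, 50, 12, 32, 19,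
       41, 18, 55, 20, 57, 2, 5, 23, 56, 58, 54, 10, 29, 3, 31, 13, 35, 39, 43, 16, 52, 40, 44,
       15, 49, 59, 53, 21, 63, 6, 33, 24, 36, 60, 62, 22, 61, 8, 7, 26, 46],
      [0, 1, 2, 6, 19, 20, 21, 22, 4, 5, 3, 16, 27, 29, 28, 32, 7, 10, 8, 14, 23, 24, 25, 26, 11,
       15, 9, 17, 30, 33, 31, 34, 35, 38, 49, 51, 37, 44, 55, 53, 36, 48, 54, 57, 41, 45, 56, 58,
       40, 42, 50, 13, 43, 46, 60, 59, 39, 12, 61, 18, 47, 52, 62, 63],
      [1, 0, 51, 6, 26, 13, 32, 7, 37, 40, 52, 8, 42, 14, 54, 12, 21, 23, 50, 29, 27, 28, 3, 35,
       39, 43, 53, 55, 45, 44, 57, 60, 2, 9, 15, 17, 4, 20, 5, 10, 38, 16, 59, 11, 46, 18, 62,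
       19, 22, 24, 25, 33, 30, 31, 34, 36, 41, 48, 56, 61, 47, 49, 58, 63]]"

text \<open>
  The enumeration of Boolean vectors varies the first entry fastest, which is the binary order of the
  columns of the table.
\<close>

definition ranked_vectors :: "(bool list \<times> int list) list" where
  "ranked_vectors = zip (List.n_lists 6 [False, True]) (transpose subset_ranks)"

text \<open>
  On Boolean vectors, componentwise \<open>\<le>\<close> is inclusion of the sets that they describe. The voting rule
  is a finite statement about 64 times 64 pairs of columns of the table.
\<close>

lemma four_of_five_ranks:
  "\<forall>(u, r) \<in> set ranked_vectors. \<forall>(v, s) \<in> set ranked_vectors.
     list_all2 (\<le>) u v \<longleftrightarrow> 4 \<le> length (filter id (map2 (\<le>) r s))"
  unfolding ranked_vectors_def subset_ranks_def
  by code_simp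

lemma ranked_vectors_wf:
  "map fst ranked_vectors = List.n_lists 6 [False, True]"
  "\<forall>(u, r) \<in> set ranked_vectors. length r = 5"
  "\<forall>j \<in> set [0..<5]. distinct (map (\<lambda>(u, r). r ! j) ranked_vectors)"
  unfolding ranked_vectors_def subset_ranks_def
  by code_simp+

definition char_vector :: "nat set \<Rightarrow> bool list" where
  "char_vector A = map (\<lambda>i. i \<in> A) [1..<7]"

definition ranks :: "nat set \<Rightarrow> int list" where
  "ranks A = the (map_of ranked_vectors (char_vector A))"

lemma list_all2_char_vector:
  assumes "A \<subseteq> {1..6}"
  shows "list_all2 (\<le>) (char_vector A) (char_vector B) \<longleftrightarrow> A \<subseteq> B"
  using assms by (auto simp: char_vector_def list_all2_map1 list_all2_map2 list_all2_same)

lemma in_ranked_vectors: "(char_vector A, ranks A) \<in> set ranked_vectors"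
proof -
  have "char_vector A \<in> set (List.n_lists 6 [False, True])"
    by (auto simp: set_n_lists char_vector_def)
  then have "char_vector A \<in> fst ` set ranked_vectors"
    by (metis ranked_vectors_wf(1) set_map)
  then show ?thesis
    by (metis map_of_eq_None_iff map_of_SomeD option.collapse ranks_def)
qed

lemma bdim_boolean_lattice_6: "bdim (boolean_lattice 6) \<le> enat 5"
proof -
  define L where "L j = pullback_on (Pow {1..6}) (\<lambda>A. ranks A ! j) {(a, b). a \<le> b}" for j
  define Ls where "Ls = map L [0..<5]"
  have len: "length (ranks A) = 5" for A
    using ranked_vectors_wf(2) in_ranked_vectors by fastforce
  have "linear_order_on (Pow {1..6}) (L j)" if "j < 5" for j
    unfolding L_def
  proof (rule linear_order_on_rank, rule inj_onI)
    fix A B :: "nat set" assume AB: "A \<in> Pow {1..6}" "B \<in> Pow {1..6}" "ranks A ! j = ranks B ! j"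
    have "inj_on (\<lambda>(u, r). r ! j) (set ranked_vectors)"
      using ranked_vectors_wf(3) that by (simp add: distinct_map)
    from inj_onD[OF this, of "(char_vector A, ranks A)" "(char_vector B, ranks B)"]
    have "char_vector A = char_vector B"
      using AB(3) in_ranked_vectors by simp
    with list_all2_char_vector[of A A] list_all2_char_vector[of B B]
      list_all2_char_vector[of A B] list_all2_char_vector[of B A] AB
    show "A = B"
      by auto
  qed
  moreover have "A \<subseteq> B \<longleftrightarrow> 4 \<le> length (filter id (comparison_vector Ls A B))"
    if "A \<subseteq> {1..6}" "B \<subseteq> {1..6}" for A B
  proof -
    have "comparison_vector Ls A B = map (\<lambda>j. ranks A ! j \<le> ranks B ! j) [0..<5]"
      using that by (simp add: comparison_vector_def Ls_def L_def pullback_on_def)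
    also have "\<dots> = map2 (\<le>) (ranks A) (ranks B)"
      by (rule nth_equalityI) (simp_all add: len)
    finally show ?thesis
      using four_of_five_ranks in_ranked_vectors[of A] in_ranked_vectors[of B]
        list_all2_char_vector[OF that(1), of B] by fastforce
  qed
  ultimately have "boolean_realizer (boolean_lattice 6) Ls (\<lambda>v. 4 \<le> length (filter id v))"
    by (auto simp: boolean_realizer_def Ls_def)
  then show ?thesis
    unfolding bdim_le_iff by (intro exI[of _ Ls]) (auto simp: Ls_def)
qed


section \<open>The upper bound\<close>

lemma bdim_boolean_lattice_6_mult: "bdim (boolean_lattice (6 * k)) \<le> enat (5 * k)"
proof (induction k)
  case 0
  show ?case
    using bdim_boolean_lattice_le[of 0] by simp
next
  case (Suc k)
  from bdim_boolean_lattice_add_le[OF bdim_boolean_lattice_6 this] show ?case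
    by simp
qed

theorem theorem5:
  fixes n :: nat
  assumes "n \<ge> 1"
  shows "bdim (boolean_lattice n) \<le> enat (nat \<lceil>5 / 6 * real n\<rceil>)"
proof -
  define k r where "k = n div 6" and "r = n mod 6"
  then have n: "n = 6 * k + r" and "r < 6"
    by simp_all
  have "bdim (boolean_lattice (6 * k + r)) \<le> enat (5 * k + r)"
    by (rule bdim_boolean_lattice_add_le[OF bdim_boolean_lattice_6_mult bdim_boolean_lattice_le])
  moreover have "\<lceil>5 / 6 * real (6 * k + r)\<rceil> = int (5 * k + r)"
    using \<open>r < 6\<close> by (intro ceiling_unique) (simp_all add: field_simps)
  ultimately show ?thesis
    unfolding n by (simp only: nat_int)
qed

end
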